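(* Let $P(w)=\frac{1}{Z}e^{-K(w)}$ be the universal prior on weight vectors $w$, and let $Q(w|\mathcal{D})=\delta_{w^*}$ be a Dirac delta at a weight vector $w^*$. Then the information in the weights, $\mathrm{KL}(Q(w|\mathcal{D})\,\|\,P(w))$, equals the Kolmogorov complexity $K(w^* )$ of the weights, up to an additive constant.
   Context: $\mathcal{D}$ is a finite dataset and $p_w(y|x)$ a model class parametrized by a weight vector $w$. $K(w)$ is the Kolmogorov complexity of $w$, measured in nats; $Z$ is the normalization constant making $P(w)=\frac1Z e^{-K(w)}$ a probability distribution over the (finitely describable) weight vectors. The "information in the weights (parameters)" of a post-distribution $Q(w|\mathcal{D})$ relative to a pre-distribution $P(w)$ is the Kullback–Leibler divergence $\mathrm{KL}(Q(w|\mathcal{D})\,\|\,P(w))$; here $\delta_{w^*}$ is the point mass at $w^*$. The constant does not depend on $w^*$ or $\mathcal{D}$. *)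

theory Defs
  imports "HOL-Probability.Probability" "HOL-Library.Sublist"
begin

subsection \<open>Partial recursive functions\<close>

datatype recf =
    Zero
  | Succ
  | Proj nat
  | Comp recf "recf list"
  | PrimRec recf recf
  | Mu recf

text \<open>
  \<open>eval f xs y\<close>: the partial recursive function denoted by \<open>f\<close> is defined at the
  argument tuple \<open>xs\<close> and has value \<open>y\<close> there. The recursion and search variable is the
  first argument; minimisation requires all earlier values to be defined and positive.
\<close>

inductive eval :: "recf \<Rightarrow> nat list \<Rightarrow> nat \<Rightarrow> bool" where
  "eval Zero xs 0"
| "eval Succ (x # xs) (Suc x)"
| "i < length xs \<Longrightarrow> eval (Proj i) xs (xs ! i)"
| "list_all2 (\<lambda>g y. eval g xs y) gs ys \<Longrightarrow> eval f ys z \<Longrightarrow> eval (Comp f gs) xs z"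
| "eval f xs y \<Longrightarrow> eval (PrimRec f g) (0 # xs) y"
| "eval (PrimRec f g) (n # xs) y \<Longrightarrow> eval g (n # y # xs) z \<Longrightarrow> eval (PrimRec f g) (Suc n # xs) z"
| "eval f (n # xs) 0 \<Longrightarrow> (\<And>m. m < n \<Longrightarrow> \<exists>y. eval f (m # xs) (Suc y)) \<Longrightarrow> eval (Mu f) xs n"
monos list_all2_mono

text \<open>The bijective base-2 numeration of binary strings.\<close>

fun string_code :: "bool list \<Rightarrow> nat" where
  "string_code [] = 0"
| "string_code (b # bs) = 2 * string_code bs + (if b then 2 else 1)"

definition partial_computable :: "(bool list \<rightharpoonup> bool list) \<Rightarrow> bool" where
  "partial_computable V \<longleftrightarrow>
     (\<exists>f. \<forall>p n. eval f [string_code p] n \<longleftrightarrow> (\<exists>x. V p = Some x \<and> n = string_code x))"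


subsection \<open>Prefix Kolmogorov complexity\<close>

definition prefix_machine :: "(bool list \<rightharpoonup> bool list) \<Rightarrow> bool" where
  "prefix_machine V \<longleftrightarrow>
     partial_computable V \<and> (\<forall>p\<in>dom V. \<forall>q\<in>dom V. prefix p q \<longrightarrow> p = q)"

text \<open>
  Universality is meant in the sense of the invariance theorem (additive optimality): up to a
  constant, no prefix machine admits shorter programs.
\<close>

definition universal_prefix_machine :: "(bool list \<rightharpoonup> bool list) \<Rightarrow> bool" where
  "universal_prefix_machine U \<longleftrightarrow>
     prefix_machine U \<and>
     (\<forall>V. prefix_machine V \<longrightarrow>
        (\<exists>c. \<forall>p x. V p = Some x \<longrightarrow> (\<exists>q. U q = Some x \<and> length q \<le> length p + c)))"

text \<open>
  Weight vectors are real vectors, of which only countably many have a finite description. A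
  description scheme \<open>desc\<close> says which binary strings name a weight vector, and which one;
  the same vector may have several names. The finitely describable vectors are \<open>ran desc\<close>.

  The complexity of \<open>w\<close> is the length of a shortest program that makes \<open>U\<close> print a name of
  \<open>w\<close>. A program of \<open>l\<close> bits has \<open>l * ln 2\<close> nats. The value is meaningful only if
  some such program exists, which universality of \<open>U\<close> guarantees for \<open>w \<in> ran desc\<close>.
\<close>

definition kolmogorov_complexity ::
    "(bool list \<rightharpoonup> bool list) \<Rightarrow> (bool list \<rightharpoonup> real ^ 'n) \<Rightarrow> real ^ 'n \<Rightarrow> real" where
  "kolmogorov_complexity U desc w =
     ln 2 * real (LEAST l. \<exists>p. length p = l \<and> (desc \<circ>\<^sub>m U) p = Some w)"


subsection \<open>Universal prior and information in the weights\<close>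

text \<open>
  If \<open>U\<close> is universal and \<open>ran desc\<close> is nonempty, then by Kraft's inequality the
  normalization constant lies in \<open>{0<..1}\<close>, so the universal prior is a probability measure
  on the countable discrete space \<open>ran desc\<close>.
\<close>

definition prior_normalization ::
    "(bool list \<rightharpoonup> bool list) \<Rightarrow> (bool list \<rightharpoonup> real ^ 'n) \<Rightarrow> real" where
  "prior_normalization U desc = (\<Sum>\<^sub>\<infinity>w\<in>ran desc. exp (- kolmogorov_complexity U desc w))"

definition universal_prior ::
    "(bool list \<rightharpoonup> bool list) \<Rightarrow> (bool list \<rightharpoonup> real ^ 'n) \<Rightarrow> (real ^ 'n) measure" where
  "universal_prior U desc =
     density (count_space (ran desc))
       (\<lambda>w. ennreal (1 / prior_normalization U desc * exp (- kolmogorov_complexity U desc w)))"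

text \<open>
  The divergence of the post-distribution \<open>Q\<close> from the pre-distribution \<open>P\<close>, in nats. The
  library's \<^const>\<open>KL_divergence\<close> takes the reference measure first.
\<close>

definition information_in_weights :: "'w measure \<Rightarrow> 'w measure \<Rightarrow> real" where
  "information_in_weights Q P = KL_divergence (exp 1) P Q"

end

theory Submission
  imports Defs
begin

text \<open>
  The point mass at \<open>w\<^sub>0\<close> has density \<open>indicator {w\<^sub>0}\<close> with respect to
  counting measure, so the divergence is \<open>- ln (P w\<^sub>0) = K w\<^sub>0 + ln Z\<close> and the
  constant is \<open>ln Z\<close>. What has to be shown is \<open>0 < Z < \<infinity>\<close>. Universality,
  applied to the machines that print a fixed string on the empty program, makes every describable
  vector have a shortest program. Shortest programs of distinct vectors are distinct elements of
  a prefix-free set, so Kraft's inequality bounds \<open>Z\<close>.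
\<close>

inductive_cases eval_Succ_elim: "eval Succ xs y"
inductive_cases eval_Proj_elim: "eval (Proj i) xs y"
inductive_cases eval_Comp_elim: "eval (Comp f gs) xs y"
inductive_cases eval_Mu_elim: "eval (Mu f) xs y"

lemma eval_Proj_iff: "eval (Proj i) xs y \<longleftrightarrow> i < length xs \<and> y = xs ! i"
  by (auto elim: eval_Proj_elim intro: eval.intros)

lemma eval_Comp_Succ_iff: "eval (Comp Succ [g]) xs z \<longleftrightarrow> (\<exists>y. eval g xs y \<and> z = Suc y)"
proof
  assume "eval (Comp Succ [g]) xs z"
  then show "\<exists>y. eval g xs y \<and> z = Suc y"
    by (rule eval_Comp_elim) (auto simp: list_all2_Cons1 elim: eval_Succ_elim)
next
  assume "\<exists>y. eval g xs y \<and> z = Suc y"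
  then obtain y where "eval g xs y" "z = Suc y" by blast
  then show "eval (Comp Succ [g]) xs z"
    using eval.intros(4)[of xs "[g]" "[y]" Succ "Suc y"] by (simp add: eval.intros(2))
qed

text \<open>\<open>Proj 1\<close> skips the search variable and reads \<open>x\<close>, so the
  search stops at its first candidate if \<open>x = 0\<close> and never stops otherwise. This
  supplies a function undefined off one input.\<close>

lemma eval_Mu_Proj_iff: "eval (Mu (Proj 1)) [x] n \<longleftrightarrow> x = 0 \<and> n = 0"
proof
  assume "eval (Mu (Proj 1)) [x] n"
  then show "x = 0 \<and> n = 0"
  proof (rule eval_Mu_elim)
    assume *: "eval (Proj 1) (n # [x]) 0"
      and min: "\<And>m. m < n \<Longrightarrow> \<exists>y. eval (Proj 1) (m # [x]) (Suc y)"
    have "x = 0" using * by (simp add: eval_Proj_iff)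
    then show ?thesis using min[of 0] by (cases n) (simp_all add: eval_Proj_iff)
  qed
next
  assume "x = 0 \<and> n = 0"
  then show "eval (Mu (Proj 1)) [x] n"
    by (auto intro!: eval.intros(7) simp: eval_Proj_iff)
qed

lemma string_code_eq_0_iff: "string_code p = 0 \<longleftrightarrow> p = []"
  by (cases p) auto

text \<open>The search halts with value 0 exactly on the code of the empty program;
  \<open>string_code x\<close> successors applied afterwards turn this 0 into the code of
  \<open>x\<close> and preserve divergence.\<close>

lemma partial_computable_single: "partial_computable [[] \<mapsto> x]"
proof -
  have iff: "eval (((\<lambda>g. Comp Succ [g]) ^^ k) (Mu (Proj 1))) [m] n \<longleftrightarrow> m = 0 \<and> n = k" for k m n
    by (induction k arbitrary: n) (auto simp: eval_Comp_Succ_iff eval_Mu_Proj_iff[simplified])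
  show ?thesis
    unfolding partial_computable_def
  proof (intro exI allI)
    fix p n
    show "eval (((\<lambda>g. Comp Succ [g]) ^^ string_code x) (Mu (Proj 1))) [string_code p] n
        \<longleftrightarrow> (\<exists>y. [[] \<mapsto> x] p = Some y \<and> n = string_code y)"
      unfolding iff string_code_eq_0_iff by simp
  qed
qed

text \<open>A one-point domain is trivially prefix-free. The overhead \<open>c\<close> may depend on
  \<open>x\<close>, which is harmless since only the existence of a program matters.\<close>

lemma universal_prefix_machine_prints:
  assumes "universal_prefix_machine U"
  shows "\<exists>p. U p = Some x"
proof -
  have "prefix_machine [[] \<mapsto> x]"
    by (auto simp: prefix_machine_def partial_computable_single)
  with assms obtain c where
    c: "\<And>p y. [[] \<mapsto> x] p = Some y \<Longrightarrow>
      \<exists>q. U q = Some y \<and> length q \<le> length (p :: bool list) + c"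
    unfolding universal_prefix_machine_def by blast
  show ?thesis using c[of "[]" x] by auto
qed

text \<open>Induction on a bound for the lengths, splitting the set by first bit: the tails in each
  half are again prefix-free and shorter.\<close>

lemma kraft_inequality:
  fixes F :: "bool list set"
  assumes "finite F" and "\<And>p q. p \<in> F \<Longrightarrow> q \<in> F \<Longrightarrow> prefix p q \<Longrightarrow> p = q"
  shows "(\<Sum>p\<in>F. (1/2::real) ^ length p) \<le> 1"
proof -
  have bounded: "(\<Sum>p\<in>F. (1/2::real) ^ length p) \<le> 1"
    if "finite F" "\<forall>p\<in>F. \<forall>q\<in>F. prefix p q \<longrightarrow> p = q" "\<forall>p\<in>F. length p \<le> N"
    for N and F :: "bool list set"
    using that
  proof (induction N arbitrary: F)
    case 0
    then have "F \<subseteq> {[]}" by auto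
    then show ?case by (auto simp: subset_singleton_iff)
  next
    case (Suc N)
    show ?case
    proof (cases "[] \<in> F")
      case True
      \<comment> \<open>The empty string is a prefix of every string.\<close>
      have "p = []" if "p \<in> F" for p
        using bspec[OF bspec[OF Suc.prems(2) True] that] by simp
      with True have "F = {[]}" by blast
      then show ?thesis by simp
    next
      case False
      define T where "T b = {p. b # p \<in> F}" for b
      have F: "F = Cons True ` T True \<union> Cons False ` T False"
      proof
        show "F \<subseteq> Cons True ` T True \<union> Cons False ` T False"
        proof
          fix p assume "p \<in> F"
          with False obtain b r where "p = b # r" by (cases p) auto
          with \<open>p \<in> F\<close> show "p \<in> Cons True ` T True \<union> Cons False ` T False"
            by (cases b) (auto simp: T_def)
        qed
      qed (auto simp: T_def)
      have fin: "finite (T b)" for b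
        unfolding T_def using finite_vimageI[OF Suc.prems(1), of "Cons b"]
        by (simp add: vimage_def)
      have le: "(\<Sum>p\<in>T b. (1/2::real) ^ length p) \<le> 1" for b
      proof (intro Suc.IH fin ballI impI)
        show "p = q" if "p \<in> T b" "q \<in> T b" "prefix p q" for p q
          using that bspec[OF bspec[OF Suc.prems(2), of "b # p"], of "b # q"]
          by (simp add: T_def)
        show "length p \<le> N" if "p \<in> T b" for p
          using that bspec[OF Suc.prems(3), of "b # p"] by (simp add: T_def)
      qed
      have "(\<Sum>p\<in>F. (1/2::real) ^ length p)
          = (\<Sum>p\<in>Cons True ` T True. (1/2) ^ length p) + (\<Sum>p\<in>Cons False ` T False. (1/2) ^ length p)"
        unfolding F by (rule sum.union_disjoint) (auto simp: fin)
      \<comment> \<open>Putting the first bit back lengthens each string by one and so halves its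
        weight.\<close>
      also have "\<dots> = (\<Sum>p\<in>T True. (1/2) ^ length p) / 2 + (\<Sum>p\<in>T False. (1/2) ^ length p) / 2"
        by (simp add: sum.reindex sum_divide_distrib)
      also have "\<dots> \<le> 1" using le[of True] le[of False] by simp
      finally show ?thesis .
    qed
  qed
  show ?thesis
  proof (rule bounded[where N = "Max (length ` F)"])
    show "\<forall>p\<in>F. \<forall>q\<in>F. prefix p q \<longrightarrow> p = q" using assms(2) by blast
    show "\<forall>p\<in>F. length p \<le> Max (length ` F)" using assms(1) by simp
  qed (rule assms(1))
qed

text \<open>The \<open>LEAST\<close> is attained because \<open>U\<close> prints some name of
  \<open>w\<close>; the factor \<open>ln 2\<close> in the complexity turns the base e into base 2,
  the form of Kraft's inequality.\<close>

lemma shortest_program: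
  assumes "universal_prefix_machine U" and "w \<in> ran desc"
  obtains p where "(desc \<circ>\<^sub>m U) p = Some w"
    and "exp (- kolmogorov_complexity U desc w) = (1/2) ^ length p"
proof -
  from assms(2) obtain x where "desc x = Some w" by (auto simp: ran_def)
  moreover obtain q where "U q = Some x"
    using universal_prefix_machine_prints[OF assms(1)] by blast
  ultimately have "\<exists>l p. length p = l \<and> (desc \<circ>\<^sub>m U) p = Some w"
    by (auto simp: map_comp_def intro!: exI[of _ q])
  from LeastI_ex[OF this] obtain p where
    p: "length p = (LEAST l. \<exists>p. length p = l \<and> (desc \<circ>\<^sub>m U) p = Some w)"
       "(desc \<circ>\<^sub>m U) p = Some w"
    by blast
  have "exp (- kolmogorov_complexity U desc w) = exp (- ln 2) ^ length p"
    unfolding kolmogorov_complexity_def p(1)[symmetric]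
    by (simp add: exp_of_nat_mult[symmetric] mult.commute)
  then have "exp (- kolmogorov_complexity U desc w) = (1/2) ^ length p"
    by (simp add: exp_minus field_simps)
  with p(2) show thesis by (rule that)
qed

lemma sum_exp_neg_kolmogorov_complexity_le:
  assumes "universal_prefix_machine U" and "finite F" and "F \<subseteq> ran desc"
  shows "(\<Sum>w\<in>F. exp (- kolmogorov_complexity U desc w)) \<le> 1"
proof -
  have "\<forall>w\<in>F. \<exists>p. (desc \<circ>\<^sub>m U) p = Some w
      \<and> exp (- kolmogorov_complexity U desc w) = (1/2) ^ length p"
    using assms(3) by (meson shortest_program[OF assms(1)] subsetD)
  then obtain p where p: "\<And>w. w \<in> F \<Longrightarrow> (desc \<circ>\<^sub>m U) (p w) = Some w"
    "\<And>w. w \<in> F \<Longrightarrow> exp (- kolmogorov_complexity U desc w) = (1/2) ^ length (p w)"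
    by metis
  \<comment> \<open>A program determines the vector that its output names.\<close>
  have inj: "inj_on p F"
    by (rule inj_onI) (metis p(1) option.inject)
  have dom: "p ` F \<subseteq> dom U"
    using p(1) by (fastforce simp: map_comp_def split: option.splits)
  have prefix_free: "q = r" if "q \<in> dom U" "r \<in> dom U" "prefix q r" for q r
    using assms(1) that unfolding universal_prefix_machine_def prefix_machine_def by blast
  have "(\<Sum>w\<in>F. exp (- kolmogorov_complexity U desc w)) = (\<Sum>q\<in>p ` F. (1/2) ^ length q)"
    by (simp add: sum.reindex[OF inj] p(2))
  also have "\<dots> \<le> 1"
  proof (rule kraft_inequality)
    show "q = r" if "q \<in> p ` F" "r \<in> p ` F" "prefix q r" for q r
      using that by (intro prefix_free subsetD[OF dom])
  qed (simp add: assms(2))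
  finally show ?thesis .
qed

lemma prior_normalization_pos:
  assumes "universal_prefix_machine U" and "w \<in> ran desc"
  shows "0 < prior_normalization U desc"
proof -
  \<comment> \<open>Without summability the infinite sum would take its default value 0. The bound
    on finite partial sums excludes this, and the single term at \<open>w\<close> then gives
    positivity.\<close>
  have "(\<lambda>w. exp (- kolmogorov_complexity U desc w)) summable_on ran desc"
    using sum_exp_neg_kolmogorov_complexity_le[OF assms(1)]
    by (intro nonneg_bdd_above_summable_on) (auto intro!: bdd_aboveI[where M = 1])
  then have "(\<Sum>w\<in>{w}. exp (- kolmogorov_complexity U desc w)) \<le> prior_normalization U desc"
    unfolding prior_normalization_def using assms(2) by (intro finite_sum_le_infsum) auto
  then show ?thesis by (simp add: less_le_trans[OF exp_gt_zero])
qed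

text \<open>Makes counting measure on the describable vectors sigma-finite, as the divergence
  formula for densities requires.\<close>

lemma countable_ran:
  fixes f :: "'a::countable \<rightharpoonup> 'b"
  shows "countable (ran f)"
proof -
  have "ran f \<subseteq> range (the \<circ> f)"
  proof
    fix y assume "y \<in> ran f"
    then obtain x where "f x = Some y" by (auto simp: ran_def)
    then show "y \<in> range (the \<circ> f)" by (intro image_eqI[of _ _ x]) simp_all
  qed
  then show ?thesis by (rule countable_subset) simp
qed

text \<open>Brings the point mass over the same base measure as the prior, so that the divergence
  becomes an integral of densities.\<close>

lemma return_count_space_eq_density:
  assumes "a \<in> A"
  shows "return (count_space A) a = density (count_space A) (\<lambda>x. ennreal (indicator {a} x))"
proof (rule measure_eqI)
  fix B assume "B \<in> sets (return (count_space A) a)"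
  then have B: "B \<subseteq> A" by simp
  have "emeasure (density (count_space A) (\<lambda>x. ennreal (indicator {a} x))) B
      = (\<integral>\<^sup>+x. indicator B a * indicator {a} x \<partial>count_space A)"
    using B by (simp add: emeasure_density)
      (rule nn_integral_cong, auto simp: indicator_def)
  \<comment> \<open>On \<open>{a}\<close> the first factor is the constant
    \<open>indicator B a\<close>, and \<open>{a}\<close> has counting measure 1.\<close>
  also have "\<dots> = indicator B a"
    using assms by (subst nn_integral_cmult_indicator) simp_all
  finally show "emeasure (return (count_space A) a) B
      = emeasure (density (count_space A) (\<lambda>x. ennreal (indicator {a} x))) B"
    using B by simp
qed simp

lemma KL_divergence_return:
  assumes "1 < b" and "countable A" and "a \<in> A" and "\<And>x. x \<in> A \<Longrightarrow> 0 < f x"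
  shows "KL_divergence b (density (count_space A) (\<lambda>x. ennreal (f x))) (return (count_space A) a)
    = - log b (f a)"
proof -
  interpret sigma_finite_measure "count_space A"
    using assms(2) by (rule sigma_finite_measure_count_space_countable)
  \<comment> \<open>Positivity of \<open>f\<close> on \<open>A\<close> gives the absolute continuity
    needed here.\<close>
  have "KL_divergence b (density (count_space A) (\<lambda>x. ennreal (f x))) (return (count_space A) a)
      = (\<integral>x. indicator {a} x * log b (indicator {a} x / f x) \<partial>count_space A)"
    unfolding return_count_space_eq_density[OF assms(3)]
    using assms(1,4)
    by (intro KL_density_density) (force simp: AE_count_space less_imp_le)+
  \<comment> \<open>Off \<open>a\<close> the indicator in front makes the integrand 0, whatever
    value the logarithm has at 0.\<close>
  also have "\<dots> = (\<integral>x. indicator {a} x * (- log b (f a)) \<partial>count_space A)"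
    using assms(3,4) by (intro Bochner_Integration.integral_cong)
      (auto simp: indicator_def log_divide less_imp_neq[symmetric])
  also have "\<dots> = - log b (f a)"
    using assms(3) by (subst Bochner_Integration.integral_mult_left_zero) simp
  finally show ?thesis .
qed

theorem proposition5p2:
  fixes U :: "bool list \<rightharpoonup> bool list"
    and desc :: "bool list \<rightharpoonup> real ^ 'n"
  assumes "universal_prefix_machine U"
  shows "\<exists>c::real. \<forall>(Q :: ('x \<times> 'y) multiset \<Rightarrow> (real ^ 'n) measure) D w\<^sub>0.
           w\<^sub>0 \<in> ran desc \<longrightarrow> Q D = return (count_space (ran desc)) w\<^sub>0 \<longrightarrow>
           information_in_weights (Q D) (universal_prior U desc)
             = kolmogorov_complexity U desc w\<^sub>0 + c"
proof (intro exI allI impI)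
  fix Q :: "('x \<times> 'y) multiset \<Rightarrow> (real ^ 'n) measure" and D w\<^sub>0
  assume w: "w\<^sub>0 \<in> ran desc" and Q: "Q D = return (count_space (ran desc)) w\<^sub>0"
  let ?Z = "prior_normalization U desc" and ?K = "kolmogorov_complexity U desc"
  have Z: "0 < ?Z" using assms w by (rule prior_normalization_pos)
  have "information_in_weights (Q D) (universal_prior U desc)
      = - log (exp 1) (1 / ?Z * exp (- ?K w\<^sub>0))"
    unfolding information_in_weights_def universal_prior_def Q
    using Z w by (intro KL_divergence_return countable_ran) auto
  also have "\<dots> = ?K w\<^sub>0 + ln ?Z"
    using Z by (simp add: log_def ln_mult ln_div)
  \<comment> \<open>This fixes the witness for \<open>c\<close>. It mentions only \<open>U\<close>
    and \<open>desc\<close>, so it is uniform in \<open>Q\<close>, \<open>D\<close> and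
    \<open>w\<^sub>0\<close>.\<close>
  finally show "information_in_weights (Q D) (universal_prior U desc) = ?K w\<^sub>0 + ln ?Z" .
qed

end
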